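(* Let $f:\mathbb{R}^n\to\mathbb{R}$ be differentiable, $\mu$-strongly convex and $L$-smooth with minimizer $x^*$ and $f^*=f(x^* )$. Let $(h_k)_{k\ge0}$ be a deterministic sequence with $0<h_k\le \frac1{\sqrt L}$, let $w_k=\frac{h_k\sqrt\mu}{1+h_k\sqrt\mu}$, and let $x_k,v_k$ be generated from an initial condition $(x_0,v_0)$ by $$y_k=(1-w_k)x_k+w_kv_k,$$ $$x_{k+1}-x_k=w_k(v_k-x_k)-\frac{h_k}{\sqrt L}(\nabla f(y_k)+e_k),$$ $$v_{k+1}-v_k=w_k(x_k-v_k)-\frac{h_k}{\sqrt\mu}(\nabla f(y_k)+e_k).$$ Let $E_k^{SC}=f(x_k)-f^*+\frac\mu2|v_k-x^*|^2$. Then for all $k\ge0$, $$E_{k+1}^{SC}\le(1-h_k\sqrt\mu)E_k^{SC}+h_k\beta_k,$$ where $$\beta_k=2h_k\left\langle\nabla f(y_k)+\frac{e_k}2,e_k\right\rangle-\left\langle\sqrt\mu\,(x_k-y_k+v_k-x^* )+\frac1{\sqrt L}\nabla f(y_k),\,e_k\right\rangle.$$ In particular, for all $k\ge 0$, $$\mathbb{E}[E_{k+1}^{SC}]\le(1-h_k\sqrt\mu)\,\mathbb{E}[E_k^{SC}]+h_k^2\sigma^2.$$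
   Context: $f$ is $L$-smooth if $f(y)-f(x)+\nabla f(x)\cdot(x-y)\le \frac L2|x-y|^2$ for all $x,y$. $f$ is $\mu$-strongly convex ($\mu>0$) if $f(x)+\nabla f(x)\cdot(y-x)\le f(y)-\frac\mu2|x-y|^2$ for all $x,y$. Stochastic gradient model: the stochastic gradient is $\widehat g(x,\xi)=\nabla f(x)+e(x,\xi)$, where for every $x$ one has $\mathbb{E}[e(x,\xi)]=0$ and $\mathrm{Var}(e(x,\xi))\le\sigma^2$, i.e. $\mathbb{E}[|e(x,\xi)|^2]\le\sigma^2$. At step $k$ the error is $e_k=e(y_k,\xi_k)$, with $\xi_k$ a fresh sample independent of the past, so that conditionally on the past (on $x_0,v_0,\xi_0,\dots,\xi_{k-1}$) $e_k$ has mean $0$ and $\mathbb{E}[|e_k|^2]\le\sigma^2$. The initial condition $(x_0,v_0)$ is deterministic. The first inequality holds for every realization of the errors. *)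

theory Defs
  imports "HOL-Probability.Probability"
begin

definition gradient :: "('a::real_inner \<Rightarrow> real) \<Rightarrow> 'a \<Rightarrow> 'a" where
  "gradient f x = (THE g. GDERIV f x :> g)"

lemma gradient_eqI: "GDERIV f x :> g \<Longrightarrow> gradient f x = g"
  unfolding gradient_def
proof (rule the_equality)
  fix g' assume g: "GDERIV f x :> g" and g': "GDERIV f x :> g'"
  then have "(\<lambda>u. g' \<bullet> u) = (\<lambda>u. g \<bullet> u)"
    unfolding gderiv_def by (metis has_derivative_unique inner_commute)
  then show "g' = g"
    by (metis vector_eq_rdot inner_commute)
qed

lemma GDERIV_gradient:
  fixes f :: "'a::euclidean_space \<Rightarrow> real"
  assumes "f differentiable (at x)"
  shows "GDERIV f x :> gradient f x"
proof -
  from assms obtain D where D: "(f has_derivative D) (at x)"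
    unfolding differentiable_def by blast
  interpret linear D
    using D by (rule has_derivative_linear)
  let ?g = "\<Sum>b\<in>Basis. D b *\<^sub>R b"
  have "D u = u \<bullet> ?g" for u
  proof -
    have "D u = D (\<Sum>b\<in>Basis. (u \<bullet> b) *\<^sub>R b)"
      by (simp add: euclidean_representation)
    also have "\<dots> = u \<bullet> ?g"
      by (simp add: sum scale inner_sum_right mult.commute)
    finally show ?thesis .
  qed
  then have "D = (\<lambda>u. u \<bullet> ?g)" by blast
  with D have "GDERIV f x :> ?g" by (simp add: gderiv_def)
  then show ?thesis by (simp add: gradient_eqI)
qed

definition L_smooth :: "real \<Rightarrow> ('a::real_inner \<Rightarrow> real) \<Rightarrow> bool" where
  "L_smooth L f \<longleftrightarrow>
     (\<forall>x y. f y - f x + gradient f x \<bullet> (x - y) \<le> L / 2 * (norm (x - y))\<^sup>2)"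

definition strongly_convex :: "real \<Rightarrow> ('a::real_inner \<Rightarrow> real) \<Rightarrow> bool" where
  "strongly_convex \<mu> f \<longleftrightarrow> \<mu> > 0 \<and>
     (\<forall>x y. f x + gradient f x \<bullet> (y - x) \<le> f y - \<mu> / 2 * (norm (x - y))\<^sup>2)"

definition momentum_weight :: "real \<Rightarrow> (nat \<Rightarrow> real) \<Rightarrow> nat \<Rightarrow> real" where
  "momentum_weight \<mu> h k = h k * sqrt \<mu> / (1 + h k * sqrt \<mu>)"

text \<open>The sequence \<open>err\<close> is one realization of the gradient errors.\<close>

definition accelerated_scheme ::
  "('a::real_inner \<Rightarrow> real) \<Rightarrow> real \<Rightarrow> real \<Rightarrow> (nat \<Rightarrow> real) \<Rightarrow> 'a \<Rightarrow> 'a \<Rightarrow>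
   (nat \<Rightarrow> 'a) \<Rightarrow> (nat \<Rightarrow> 'a) \<Rightarrow> (nat \<Rightarrow> 'a) \<Rightarrow> (nat \<Rightarrow> 'a) \<Rightarrow> bool" where
  "accelerated_scheme f \<mu> L h x0 v0 err x y v \<longleftrightarrow>
     x 0 = x0 \<and> v 0 = v0 \<and>
     (\<forall>k. let w = momentum_weight \<mu> h k in
        y k = (1 - w) *\<^sub>R x k + w *\<^sub>R v k \<and>
        x (Suc k) - x k
          = w *\<^sub>R (v k - x k) - (h k / sqrt L) *\<^sub>R (gradient f (y k) + err k) \<and>
        v (Suc k) - v k
          = w *\<^sub>R (x k - v k) - (h k / sqrt \<mu>) *\<^sub>R (gradient f (y k) + err k))"

definition energy_SC ::
  "('a::real_inner \<Rightarrow> real) \<Rightarrow> real \<Rightarrow> 'a \<Rightarrow> 'a \<Rightarrow> 'a \<Rightarrow> real" where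
  "energy_SC f \<mu> xstar x v = f x - f xstar + \<mu> / 2 * (norm (v - xstar))\<^sup>2"

definition error_term ::
  "('a::real_inner \<Rightarrow> real) \<Rightarrow> real \<Rightarrow> real \<Rightarrow> real \<Rightarrow> 'a \<Rightarrow> 'a \<Rightarrow> 'a \<Rightarrow> 'a \<Rightarrow> 'a \<Rightarrow> real" where
  "error_term f \<mu> L h xstar x y v e =
     2 * h * ((gradient f y + e /\<^sub>R 2) \<bullet> e)
     - (sqrt \<mu> *\<^sub>R (x - y + v - xstar) + (1 / sqrt L) *\<^sub>R gradient f y) \<bullet> e"

text \<open>\<open>D\<close> is the law of a generic sample and \<open>e x s\<close> the gradient error at the point \<open>x\<close> for the
  sample \<open>s\<close>. The samples \<open>\<xi> 0, \<xi> 1, \<dots>\<close> are independent with law \<open>D\<close>. Integrability is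
  stated explicitly because the Bochner integral of a non-integrable function is \<open>0\<close>.\<close>

locale stochastic_gradient_error = prob_space M
  for M :: "'w measure" +
  fixes D :: "'s measure"
    and \<xi> :: "nat \<Rightarrow> 'w \<Rightarrow> 's"
    and e :: "'a::euclidean_space \<Rightarrow> 's \<Rightarrow> 'a"
    and \<sigma> :: real
  assumes indep_samples: "indep_vars (\<lambda>_. D) \<xi> UNIV"
    and law_sample: "\<And>k. distr M D (\<xi> k) = D"
    and measurable_error: "(\<lambda>(x, s). e x s) \<in> borel_measurable (borel \<Otimes>\<^sub>M D)"
    and integrable_error: "\<And>x. integrable D (e x)"
    and mean_error: "\<And>x. (\<integral>s. e x s \<partial>D) = 0"
    and square_integrable_error: "\<And>x. integrable D (\<lambda>s. (norm (e x s))\<^sup>2)"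
    and variance_error: "\<And>x. (\<integral>s. (norm (e x s))\<^sup>2 \<partial>D) \<le> \<sigma>\<^sup>2"

end

theory Submission
  imports Defs
begin

text \<open>Write \<open>a = h k * sqrt \<mu>\<close>, \<open>u = v k - xstar\<close> and \<open>d = v k - y k\<close>, so that
  \<open>y k - x k = a *\<^sub>R d\<close>. The gradient step is bounded by smoothness between \<open>x (Suc k)\<close> and \<open>y k\<close>;
  \<open>f (y k)\<close> is compared with \<open>f (x k)\<close> and \<open>f xstar\<close> by strong convexity, and \<open>a * f (x k)\<close> with
  \<open>a * f (y k)\<close> by smoothness once more. In the sum with the expanded \<open>(norm (v (Suc k) - xstar))\<^sup>2\<close>
  all products \<open>gradient f (y k) \<bullet> d\<close> cancel, and the remaining squares have the right sign because
  \<open>h k * sqrt L \<le> 1\<close>. For the expectation, \<open>x k\<close>, \<open>y k\<close>, \<open>v k\<close> depend on the samples before time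
  \<open>k\<close> only and are square integrable (the gradient is Lipschitz), so by Fubini the error at time \<open>k\<close>
  is uncorrelated with them and only the term \<open>(h k)\<^sup>2 * (norm (err k))\<^sup>2\<close> survives.\<close>

section \<open>Energy inequality for one realization\<close>

lemma strongly_convexD:
  "strongly_convex \<mu> f \<Longrightarrow> f x + gradient f x \<bullet> (y - x) \<le> f y - \<mu> / 2 * (norm (x - y))\<^sup>2"
  by (simp add: strongly_convex_def)

lemma L_smoothD:
  "L_smooth L f \<Longrightarrow> f y \<le> f x + gradient f x \<bullet> (y - x) + L / 2 * (norm (x - y))\<^sup>2"
  unfolding L_smooth_def by (smt (verit) inner_minus_right minus_diff_eq)

lemma energy_decrease:
  fixes f :: "'a::real_inner \<Rightarrow> real"
  assumes convex: "strongly_convex \<mu> f" and smooth: "L_smooth L f"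
    and h: "0 < h k" "h k \<le> 1 / sqrt L"
    and scheme: "accelerated_scheme f \<mu> L h x0 v0 err x y v"
  shows "energy_SC f \<mu> xstar (x (Suc k)) (v (Suc k))
      \<le> (1 - h k * sqrt \<mu>) * energy_SC f \<mu> xstar (x k) (v k)
        + h k * error_term f \<mu> L (h k) xstar (x k) (y k) (v k) (err k)"
proof -
  define s l a where "s = sqrt \<mu>" and "l = sqrt L" and "a = h k * s"
  have "0 < s" using convex by (simp add: strongly_convex_def s_def)
  \<comment> \<open>Positivity of \<open>L\<close> comes from the step sizes: in HOL
    \<open>1 / sqrt L\<close> is positive only for \<open>0 < L\<close>, as \<open>1 / 0 = 0\<close>
    and \<open>sqrt\<close> is negative on negative numbers.\<close>
  have "0 < 1 / sqrt L" using h by linarith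
  then have "0 < l" by (simp add: l_def)
  have \<mu>: "\<mu> = s\<^sup>2" and L: "L = l\<^sup>2"
    using \<open>0 < s\<close> \<open>0 < l\<close> by (simp_all add: s_def l_def)
  have "0 < a" using h \<open>0 < s\<close> by (simp add: a_def)
  define g e u d where "g = gradient f (y k)" and "e = err k"
    and "u = v k - xstar" and "d = v k - y k"
  define w where "w = momentum_weight \<mu> h k"
  have w: "w = a / (1 + a)" by (simp add: w_def momentum_weight_def a_def s_def)
  have y: "y k = (1 - w) *\<^sub>R x k + w *\<^sub>R v k"
    and x': "x (Suc k) - x k = w *\<^sub>R (v k - x k) - (h k / l) *\<^sub>R (g + e)"
    and v': "v (Suc k) - v k = w *\<^sub>R (x k - v k) - (h k / s) *\<^sub>R (g + e)"
    using scheme unfolding accelerated_scheme_def Let_def w_def s_def l_def g_def e_def by blast+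
  have d: "d = (1 - w) *\<^sub>R (v k - x k)"
    unfolding d_def y by (simp add: algebra_simps)
  \<comment> \<open>Since \<open>1 - w = 1 / (1 + a)\<close>, the coupling terms of both updates
    become \<open>a *\<^sub>R d\<close> up to sign.\<close>
  have "a * (1 - w) = w" using \<open>0 < a\<close> by (simp add: w field_simps)
  then have ad: "a *\<^sub>R d = w *\<^sub>R (v k - x k)"
    by (simp add: d)
  also have "\<dots> = y k - x k" unfolding y by (simp add: algebra_simps)
  finally have yx: "x k - y k = - (a *\<^sub>R d)" by simp
  have xy': "x (Suc k) - y k = - ((h k / l) *\<^sub>R (g + e))"
  proof -
    have "x (Suc k) - y k = (x (Suc k) - x k) + (x k - y k)" by simp
    then show ?thesis unfolding x' yx ad by simp
  qed
  have vu': "v (Suc k) - xstar = u - a *\<^sub>R d - (h k / s) *\<^sub>R (g + e)"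
  proof -
    have "v (Suc k) - xstar = (v (Suc k) - v k) + u" by (simp add: u_def)
    then show ?thesis unfolding v' ad by (simp add: algebra_simps)
  qed
  have yu: "xstar - y k = d - u" by (simp add: u_def d_def)
  \<comment> \<open>The step \<open>h k / l\<close> cancels the smoothness constant
    \<open>l\<^sup>2\<close>, leaving the same quadratic term that the velocity update produces in
    \<open>kin\<close>.\<close>
  have sq: "l\<^sup>2 / 2 * ((- ((h k / l) *\<^sub>R (g + e))) \<bullet> (- ((h k / l) *\<^sub>R (g + e))))
      = (h k)\<^sup>2 / 2 * ((g + e) \<bullet> (g + e))"
    using \<open>0 < l\<close> unfolding inner_minus_left inner_minus_right inner_scaleR_left inner_scaleR_right
    by (simp add: power2_eq_square)
  have 1: "f (x (Suc k)) \<le> f (y k) - h k / l * (g \<bullet> (g + e)) + (h k)\<^sup>2 / 2 * ((g + e) \<bullet> (g + e))"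
    using L_smoothD[OF smooth, of "x (Suc k)" "y k"] \<open>0 < l\<close>
    unfolding norm_minus_commute[of "y k"] xy' power2_norm_eq_inner g_def[symmetric] L sq
    by simp
  have 2: "f (y k) - a * (g \<bullet> d) \<le> f (x k) - s\<^sup>2 * a\<^sup>2 / 2 * (d \<bullet> d)"
    using strongly_convexD[OF convex, of "y k" "x k"]
    unfolding norm_minus_commute[of "y k"] yx power2_norm_eq_inner g_def[symmetric]
    by (simp add: \<mu> power2_eq_square)
  have 3: "f (y k) + g \<bullet> (d - u) \<le> f xstar - s\<^sup>2 / 2 * ((d - u) \<bullet> (d - u))"
    using strongly_convexD[OF convex, of "y k" xstar]
    unfolding norm_minus_commute[of "y k"] yu power2_norm_eq_inner g_def[symmetric]
    by (simp add: \<mu>)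
  have 4: "f (x k) \<le> f (y k) - a * (g \<bullet> d) + l\<^sup>2 * a\<^sup>2 / 2 * (d \<bullet> d)"
    using L_smoothD[OF smooth, of "x k" "y k"]
    unfolding norm_minus_commute[of "y k"] yx power2_norm_eq_inner g_def[symmetric]
    by (simp add: L power2_eq_square)
  have hl: "h k * l \<le> 1"
    using h \<open>0 < l\<close> by (simp add: l_def[symmetric] field_simps)
  have 5: "(h k)\<^sup>2 * (g \<bullet> g) \<le> h k / l * (g \<bullet> g)"
  proof (rule mult_right_mono)
    show "(h k)\<^sup>2 \<le> h k / l"
      using mult_left_mono[OF hl, of "h k"] h(1) \<open>0 < l\<close> by (simp add: field_simps power2_eq_square)
  qed simp
  \<comment> \<open>Because \<open>l\<^sup>2 * a\<^sup>2 = (h k * l)\<^sup>2 * s\<^sup>2\<close>,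
    the smoothness loss in 4 is paid for by the strong convexity gain in 3.\<close>
  have 6: "a * (l\<^sup>2 * a\<^sup>2 / 2 * (d \<bullet> d)) \<le> a * (s\<^sup>2 / 2 * (d \<bullet> d))"
  proof -
    have "(h k * l)\<^sup>2 \<le> 1" using hl h(1) \<open>0 < l\<close> by (simp add: power_le_one)
    then have "(h k * l)\<^sup>2 * s\<^sup>2 \<le> 1 * s\<^sup>2" by (intro mult_right_mono) auto
    then have "l\<^sup>2 * a\<^sup>2 \<le> s\<^sup>2" by (simp add: a_def power_mult_distrib mult_ac)
    then show ?thesis using \<open>0 < a\<close> by (intro mult_left_mono mult_right_mono) auto
  qed
  \<comment> \<open>Adding 3 and 4 removes \<open>f (y k)\<close>. Scaled by \<open>a\<close>, the
    sum trades the term \<open>- a * (g \<bullet> u)\<close> of \<open>kin\<close> for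
    \<open>- a * (f (x k) - f xstar)\<close>, the source of the factor \<open>1 - a\<close>.\<close>
  have 34: "a * (f (x k) + g \<bullet> (d - u)) \<le> a * (f xstar - s\<^sup>2 / 2 * ((d - u) \<bullet> (d - u))
      - a * (g \<bullet> d) + l\<^sup>2 * a\<^sup>2 / 2 * (d \<bullet> d))"
    using 3 4 \<open>0 < a\<close> by (intro mult_left_mono) linarith+
  have kin: "s\<^sup>2 / 2 * ((u - a *\<^sub>R d - (h k / s) *\<^sub>R (g + e)) \<bullet> (u - a *\<^sub>R d - (h k / s) *\<^sub>R (g + e)))
      = s\<^sup>2 / 2 * (u \<bullet> u) - s\<^sup>2 * a * (u \<bullet> d) - a * (u \<bullet> (g + e)) + s\<^sup>2 * a\<^sup>2 / 2 * (d \<bullet> d)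
        + a\<^sup>2 * (d \<bullet> (g + e)) + (h k)\<^sup>2 / 2 * ((g + e) \<bullet> (g + e))"
    using \<open>0 < s\<close>
    by (simp add: inner_diff_left inner_diff_right inner_commute a_def) (simp add: field_simps power2_eq_square)
  have err: "h k * error_term f \<mu> L (h k) xstar (x k) (y k) (v k) (err k)
      = 2 * (h k)\<^sup>2 * (g \<bullet> e) + (h k)\<^sup>2 * (e \<bullet> e) + a\<^sup>2 * (d \<bullet> e) - a * (u \<bullet> e) - h k / l * (g \<bullet> e)"
  proof -
    have "x k - y k + v k - xstar = u - a *\<^sub>R d" using yx by (simp add: u_def)
    then show ?thesis
      unfolding error_term_def g_def[symmetric] e_def[symmetric] s_def[symmetric] l_def[symmetric]
      by (simp add: inner_simps a_def) (simp add: field_simps power2_eq_square)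
  qed
  have expand: "g \<bullet> (g + e) = g \<bullet> g + g \<bullet> e" "u \<bullet> (g + e) = g \<bullet> u + u \<bullet> e"
    "d \<bullet> (g + e) = g \<bullet> d + d \<bullet> e" "(g + e) \<bullet> (g + e) = g \<bullet> g + 2 * (g \<bullet> e) + e \<bullet> e"
    "g \<bullet> (d - u) = g \<bullet> d - g \<bullet> u" "(d - u) \<bullet> (d - u) = d \<bullet> d - 2 * (u \<bullet> d) + u \<bullet> u"
    by (simp_all add: inner_simps inner_commute)
  \<comment> \<open>The \<open>d \<bullet> d\<close> terms of 2 and \<open>kin\<close> cancel, and
    the \<open>u \<bullet> u\<close> term of 34 contracts the kinetic energy. The two halves of
    \<open>(h k)\<^sup>2 * ((g + e) \<bullet> (g + e))\<close> from 1 and \<open>kin\<close> add up: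
    5 absorbs the part \<open>g \<bullet> g\<close>, and all terms containing \<open>e\<close>
    together are exactly \<open>err\<close>.\<close>
  have "f (x (Suc k)) - f xstar + s\<^sup>2 / 2 * ((u - a *\<^sub>R d - (h k / s) *\<^sub>R (g + e)) \<bullet> (u - a *\<^sub>R d - (h k / s) *\<^sub>R (g + e)))
      \<le> (1 - a) * (f (x k) - f xstar + s\<^sup>2 / 2 * (u \<bullet> u)) + h k * error_term f \<mu> L (h k) xstar (x k) (y k) (v k) (err k)"
    using 1 2 34 5 6 unfolding kin err unfolding expand by (simp add: algebra_simps add_divide_distrib diff_divide_distrib power2_eq_square)
  then show ?thesis
    unfolding energy_SC_def vu' power2_norm_eq_inner
    unfolding s_def[symmetric] a_def[symmetric] u_def[symmetric]
    unfolding \<mu> .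
qed

section \<open>Lipschitz continuity of the gradient\<close>

text \<open>Convexity at \<open>x\<close> bounds \<open>f z\<close> from below and smoothness at
  \<open>y\<close> bounds it from above. For a well chosen \<open>z\<close> this puts
  \<open>(norm \<Delta>)\<^sup>2 / (2 * L)\<close> below the Bregman distance
  \<open>f y - f x - gradient f x \<bullet> (y - x)\<close>, to which smoothness applies
  again.\<close>

lemma gradient_lipschitz:
  fixes f :: "'a::real_inner \<Rightarrow> real"
  assumes convex: "strongly_convex \<mu> f" and smooth: "L_smooth L f" and "0 < L"
  shows "norm (gradient f y - gradient f x) \<le> L * norm (y - x)"
proof -
  define \<Delta> where "\<Delta> = gradient f y - gradient f x"
  \<comment> \<open>A gradient step of length \<open>1 / L\<close> from \<open>y\<close> for
    \<open>f\<close> minus the linear map \<open>gradient f x\<close>, whose gradient at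
    \<open>y\<close> is \<open>\<Delta>\<close>; it minimizes the quadratic upper model at
    \<open>y\<close>.\<close>
  define z where "z = y - (1 / L) *\<^sub>R \<Delta>"
  have "0 < \<mu>" using convex by (simp add: strongly_convex_def)
  then have "f x + gradient f x \<bullet> (z - x) \<le> f z"
    using strongly_convexD[OF convex, of x z] by (smt (verit) zero_le_power2 mult_nonneg_nonneg half_gt_zero)
  also have "\<dots> \<le> f y + gradient f y \<bullet> (z - y) + L / 2 * (norm (y - z))\<^sup>2"
    by (rule L_smoothD[OF smooth])
  also have "L / 2 * (norm (y - z))\<^sup>2 = (norm \<Delta>)\<^sup>2 / (2 * L)"
    using \<open>0 < L\<close> by (simp add: z_def power2_eq_square)
  finally have upper: "f x + gradient f x \<bullet> (z - x)
      \<le> f y + gradient f y \<bullet> (z - y) + (norm \<Delta>)\<^sup>2 / (2 * L)" .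
  have "gradient f y \<bullet> (z - y) - gradient f x \<bullet> (z - x) = gradient f x \<bullet> (x - y) + \<Delta> \<bullet> (z - y)"
    by (simp add: \<Delta>_def inner_simps)
  moreover have "\<Delta> \<bullet> (z - y) = - (2 * ((norm \<Delta>)\<^sup>2 / (2 * L)))"
    by (simp add: z_def power2_norm_eq_inner)
  ultimately have "(norm \<Delta>)\<^sup>2 / (2 * L) \<le> f y - f x - gradient f x \<bullet> (y - x)"
    using upper by (simp add: inner_diff_right)
  also have "\<dots> \<le> L / 2 * (norm (y - x))\<^sup>2"
    using L_smoothD[OF smooth, of y x] by (simp add: norm_minus_commute)
  finally have "(norm \<Delta>)\<^sup>2 \<le> (L * norm (y - x))\<^sup>2"
    using \<open>0 < L\<close> by (simp add: field_simps power2_eq_square)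
  then show ?thesis
    using \<open>0 < L\<close> unfolding \<Delta>_def by (auto intro: power2_le_imp_le)
qed

lemma lipschitz_on_gradient:
  fixes f :: "'a::real_inner \<Rightarrow> real"
  assumes "strongly_convex \<mu> f" "L_smooth L f" "0 < L"
  shows "L-lipschitz_on UNIV (gradient f)"
  using assms gradient_lipschitz[OF assms] by (auto intro!: lipschitz_onI simp: dist_norm)

section \<open>Square integrable random vectors\<close>

text \<open>Measurability refers to the full measure \<open>M\<close>; measurability in the past is
  tracked separately. It is stated explicitly because a measurable norm does not make
  \<open>X\<close> measurable.\<close>

definition square_integrable :: "'w measure \<Rightarrow> ('w \<Rightarrow> 'a::euclidean_space) \<Rightarrow> bool" where
  "square_integrable M X \<longleftrightarrow> X \<in> borel_measurable M \<and> integrable M (\<lambda>\<omega>. (norm (X \<omega>))\<^sup>2)"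

lemma square_integrable_bound:
  assumes "X \<in> borel_measurable M" "integrable M b" "\<And>\<omega>. \<omega> \<in> space M \<Longrightarrow> (norm (X \<omega>))\<^sup>2 \<le> b \<omega>"
  shows "square_integrable M X"
  unfolding square_integrable_def
proof
  show "integrable M (\<lambda>\<omega>. (norm (X \<omega>))\<^sup>2)"
  proof (rule Bochner_Integration.integrable_bound[OF assms(2)])
    show "AE \<omega> in M. norm ((norm (X \<omega>))\<^sup>2) \<le> norm (b \<omega>)"
    proof (rule AE_I2)
      fix \<omega> assume "\<omega> \<in> space M"
      from order_trans[OF assms(3)[OF this] abs_ge_self] show "norm ((norm (X \<omega>))\<^sup>2) \<le> norm (b \<omega>)"
        by simp
    qed
  qed (use assms(1) in measurable)
qed (rule assms(1))

lemma square_integrable_scaleR: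
  "square_integrable M X \<Longrightarrow> square_integrable M (\<lambda>\<omega>. c *\<^sub>R X \<omega>)"
  by (auto simp: square_integrable_def power_mult_distrib)

lemma square_integrable_add:
  assumes "square_integrable M X" "square_integrable M Y"
  shows "square_integrable M (\<lambda>\<omega>. X \<omega> + Y \<omega>)"
proof (rule square_integrable_bound)
  show "(\<lambda>\<omega>. X \<omega> + Y \<omega>) \<in> borel_measurable M"
    using assms by (auto simp: square_integrable_def)
  show "integrable M (\<lambda>\<omega>. 2 * (norm (X \<omega>))\<^sup>2 + 2 * (norm (Y \<omega>))\<^sup>2)"
    using assms by (auto simp: square_integrable_def)
  show "(norm (X \<omega> + Y \<omega>))\<^sup>2 \<le> 2 * (norm (X \<omega>))\<^sup>2 + 2 * (norm (Y \<omega>))\<^sup>2" for \<omega>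
    \<comment> \<open>By the parallelogram law, this square is the gap between the two
      sides.\<close>
    using zero_le_power2[of "norm (X \<omega> - Y \<omega>)"]
    by (simp add: power2_norm_eq_inner inner_simps inner_commute)
qed

lemma square_integrable_diff:
  assumes "square_integrable M X" "square_integrable M Y"
  shows "square_integrable M (\<lambda>\<omega>. X \<omega> - Y \<omega>)"
  using square_integrable_add[OF assms(1) square_integrable_scaleR[OF assms(2), of "-1"]] by simp

lemma (in finite_measure) square_integrable_const: "square_integrable M (\<lambda>_. c)"
  by (simp add: square_integrable_def)

lemma square_integrable_cong:
  assumes "\<And>\<omega>. \<omega> \<in> space M \<Longrightarrow> X \<omega> = Y \<omega>"
  shows "square_integrable M X = square_integrable M Y"
  unfolding square_integrable_def
  using assms by (simp cong: measurable_cong Bochner_Integration.integrable_cong)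

lemma (in finite_measure) square_integrable_lipschitz:
  fixes g :: "'b::euclidean_space \<Rightarrow> 'c::euclidean_space"
  assumes X: "square_integrable M X" and g: "C-lipschitz_on UNIV g"
  shows "square_integrable M (\<lambda>\<omega>. g (X \<omega>))"
proof -
  have g_meas: "g \<in> borel_measurable borel"
    using g by (intro borel_measurable_continuous_onI lipschitz_on_continuous_on)
  \<comment> \<open>After subtracting \<open>g 0\<close> the Lipschitz condition gives a bound by
    \<open>C * norm (X \<omega>)\<close> alone; the constant is restored at the end, the measure
    being finite.\<close>
  have "square_integrable M (\<lambda>\<omega>. g (X \<omega>) - g 0)"
  proof (rule square_integrable_bound)
    show "(\<lambda>\<omega>. g (X \<omega>) - g 0) \<in> borel_measurable M"
      using X g_meas by (auto simp: square_integrable_def)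
    show "integrable M (\<lambda>\<omega>. C\<^sup>2 * (norm (X \<omega>))\<^sup>2)"
      using X by (auto simp: square_integrable_def)
    show "(norm (g (X \<omega>) - g 0))\<^sup>2 \<le> C\<^sup>2 * (norm (X \<omega>))\<^sup>2" for \<omega>
      using lipschitz_onD[OF g, of "X \<omega>" 0] power_mono[of "norm (g (X \<omega>) - g 0)" "C * norm (X \<omega>)" 2]
      by (simp add: dist_norm power_mult_distrib)
  qed
  from square_integrable_add[OF this square_integrable_const[of "g 0"]] show ?thesis by simp
qed

lemma square_integrable_inner:
  assumes "square_integrable M X" "square_integrable M Y"
  shows "integrable M (\<lambda>\<omega>. X \<omega> \<bullet> Y \<omega>)"
proof -
  \<comment> \<open>Polarization reduces the inner product to three integrable squares.\<close>
  have "integrable M (\<lambda>\<omega>. ((norm (X \<omega> + Y \<omega>))\<^sup>2 - (norm (X \<omega>))\<^sup>2 - (norm (Y \<omega>))\<^sup>2) / 2)"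
    using assms square_integrable_add[OF assms] by (simp add: square_integrable_def)
  then show ?thesis by (simp add: dot_norm)
qed

section \<open>Independence of the past and the fresh sample\<close>

context stochastic_gradient_error
begin

text \<open>Only samples strictly before \<open>k\<close> enter, so \<open>\<xi> k\<close> is fresh
  at time \<open>k\<close>, and \<open>past 0\<close> is trivial, matching the deterministic start.
  The pullback of a finite product fits the independence of disjoint blocks of samples.\<close>

definition past :: "nat \<Rightarrow> 'w measure" where
  "past k = vimage_algebra (space M) (\<lambda>\<omega>. \<lambda>i\<in>{..<k}. \<xi> i \<omega>) (\<Pi>\<^sub>M i\<in>{..<k}. D)"

lemma measurable_sample [measurable]: "\<xi> k \<in> measurable M D"
  using indep_samples by (simp add: indep_vars_def)

lemma prob_space_D: "prob_space D"
  using prob_space_distr[OF measurable_sample] by (simp add: law_sample)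

lemma space_past [simp]: "space (past k) = space M"
  by (simp add: past_def)

lemma measurable_past_imp_measurable: "X \<in> measurable (past k) N \<Longrightarrow> X \<in> measurable M N"
proof -
  have "sets (past k) \<subseteq> sets M"
    unfolding past_def by (rule sets_image_in_sets) auto
  then show "X \<in> measurable (past k) N \<Longrightarrow> X \<in> measurable M N"
    using measurable_mono[of N N "past k" M] by auto
qed

lemma sample_measurable_past: "i < k \<Longrightarrow> \<xi> i \<in> measurable (past k) D"
proof -
  assume "i < k"
  have "(\<lambda>\<omega>. \<lambda>i\<in>{..<k}. \<xi> i \<omega>) \<in> measurable (past k) (\<Pi>\<^sub>M i\<in>{..<k}. D)"
    unfolding past_def
    by (rule measurable_vimage_algebra1) (auto simp: space_PiM measurable_space[OF measurable_sample])
  from measurable_compose[OF this measurable_component_singleton, of i] \<open>i < k\<close>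
  show ?thesis by simp
qed

lemma measurable_past_Suc: "X \<in> measurable (past k) N \<Longrightarrow> X \<in> measurable (past (Suc k)) N"
proof -
  have "sets (past k) \<subseteq> sets (past (Suc k))"
    unfolding past_def[of k]
    by (rule sets_image_in_sets) (auto intro!: measurable_restrict sample_measurable_past)
  then show "X \<in> measurable (past k) N \<Longrightarrow> X \<in> measurable (past (Suc k)) N"
    using measurable_mono[of N N "past k" "past (Suc k)"] by auto
qed

text \<open>An event of \<open>past k\<close> is the preimage of a set under the tuple of earlier
  samples, and this tuple and \<open>\<xi> k\<close> use disjoint index sets of an independent
  family.\<close>

lemma indep_past_sample:
  assumes X: "X \<in> measurable (past k) N" and A: "A \<in> sets N" and B: "B \<in> sets D"
  shows "prob ((X -` A \<inter> space M) \<inter> (\<xi> k -` B \<inter> space M))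
    = prob (X -` A \<inter> space M) * prob (\<xi> k -` B \<inter> space M)"
proof -
  let ?H = "\<lambda>\<omega>. \<lambda>i\<in>{..<k}. \<xi> i \<omega>" and ?S = "\<lambda>\<omega>. \<lambda>i\<in>{k}. \<xi> i \<omega>"
  \<comment> \<open>The set \<open>B\<close> lifted to families indexed by \<open>{k}\<close>, since
    independence is available for blocks of indices.\<close>
  let ?B = "(\<lambda>z. z k) -` B \<inter> space (\<Pi>\<^sub>M i\<in>{k}. D)"
  have "X -` A \<inter> space M \<in> sets (past k)"
    using measurable_sets[OF X A] by simp
  moreover have "?H \<in> space M \<rightarrow> space (\<Pi>\<^sub>M i\<in>{..<k}. D)"
    by (auto simp: space_PiM measurable_space[OF measurable_sample])
  ultimately obtain A' where A': "A' \<in> sets (\<Pi>\<^sub>M i\<in>{..<k}. D)" "X -` A \<inter> space M = ?H -` A' \<inter> space M"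
    unfolding past_def by (auto simp: sets_vimage_algebra2)
  have B': "?B \<in> sets (\<Pi>\<^sub>M i\<in>{k}. D)"
    using B by (intro measurable_sets[OF measurable_component_singleton]) auto
  have \<xi>: "\<xi> k -` B \<inter> space M = ?S -` ?B \<inter> space M"
    by (auto simp: space_PiM measurable_space[OF measurable_sample])
  have "indep_var (\<Pi>\<^sub>M i\<in>{..<k}. D) ?H (\<Pi>\<^sub>M i\<in>{k}. D) ?S"
    by (rule indep_var_restrict[OF indep_samples]) auto
  from indep_varD[OF this A'(1) B'] show ?thesis
    unfolding A'(2) \<xi> by (simp add: Times_Int_distrib1 vimage_def Int_def conj_ac)
qed

text \<open>Independence in the form that Fubini needs; agreement on rectangles determines a product
  of sigma-finite measures.\<close>

lemma joint_law:
  assumes X: "X \<in> measurable (past k) N"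
  shows "distr M (N \<Otimes>\<^sub>M D) (\<lambda>\<omega>. (X \<omega>, \<xi> k \<omega>)) = distr M N X \<Otimes>\<^sub>M D"
proof (rule pair_measure_eqI[symmetric])
  note [measurable] = measurable_past_imp_measurable[OF X]
  show "sigma_finite_measure (distr M N X)"
    by (intro prob_space_imp_sigma_finite prob_space_distr) measurable
  show "sigma_finite_measure D"
    by (intro prob_space_imp_sigma_finite prob_space_D)
  show "sets (distr M N X \<Otimes>\<^sub>M D) = sets (distr M (N \<Otimes>\<^sub>M D) (\<lambda>\<omega>. (X \<omega>, \<xi> k \<omega>)))"
    by (simp cong: sets_pair_measure_cong)
  fix A B assume "A \<in> sets (distr M N X)" "B \<in> sets D"
  then have [measurable]: "A \<in> sets N" "B \<in> sets D" by auto
  have "emeasure D B = emeasure M (\<xi> k -` B \<inter> space M)"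
    by (subst law_sample[of k, symmetric]) (simp add: emeasure_distr)
  moreover have "(\<lambda>\<omega>. (X \<omega>, \<xi> k \<omega>)) -` (A \<times> B) \<inter> space M
      = (X -` A \<inter> space M) \<inter> (\<xi> k -` B \<inter> space M)"
    by auto
  ultimately show "emeasure (distr M N X) A * emeasure D B
      = emeasure (distr M (N \<Otimes>\<^sub>M D) (\<lambda>\<omega>. (X \<omega>, \<xi> k \<omega>))) (A \<times> B)"
    using indep_past_sample[OF X, of A B]
    by (simp add: emeasure_distr emeasure_eq_measure ennreal_mult)
qed

text \<open>Replaces conditioning on the past: \<open>X\<close> is frozen and the fresh sample
  integrated out. The nonnegative version asks for no integrability and so can establish it.\<close>

lemma nn_integral_fresh_sample:
  assumes X: "X \<in> measurable (past k) N" and \<phi>: "\<phi> \<in> borel_measurable (N \<Otimes>\<^sub>M D)"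
  shows "(\<integral>\<^sup>+\<omega>. \<phi> (X \<omega>, \<xi> k \<omega>) \<partial>M) = (\<integral>\<^sup>+\<omega>. (\<integral>\<^sup>+s. \<phi> (X \<omega>, s) \<partial>D) \<partial>M)"
proof -
  interpret D: prob_space D by (rule prob_space_D)
  note [measurable] = measurable_past_imp_measurable[OF X] \<phi>
  have "(\<integral>\<^sup>+\<omega>. \<phi> (X \<omega>, \<xi> k \<omega>) \<partial>M) = (\<integral>\<^sup>+p. \<phi> p \<partial>distr M (N \<Otimes>\<^sub>M D) (\<lambda>\<omega>. (X \<omega>, \<xi> k \<omega>)))"
    by (simp add: nn_integral_distr)
  also have "\<dots> = (\<integral>\<^sup>+x. (\<integral>\<^sup>+s. \<phi> (x, s) \<partial>D) \<partial>distr M N X)"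
    unfolding joint_law[OF X] by (rule D.nn_integral_fst[symmetric]) simp
  also have "\<dots> = (\<integral>\<^sup>+\<omega>. (\<integral>\<^sup>+s. \<phi> (X \<omega>, s) \<partial>D) \<partial>M)"
    by (rule nn_integral_distr) measurable
  finally show ?thesis .
qed

text \<open>The signed counterpart, used for mean zero; here joint integrability must be known
  beforehand.\<close>

lemma integral_fresh_sample:
  fixes \<phi> :: "_ \<Rightarrow> real"
  assumes X: "X \<in> measurable (past k) N" and \<phi>: "\<phi> \<in> borel_measurable (N \<Otimes>\<^sub>M D)"
    and int: "integrable M (\<lambda>\<omega>. \<phi> (X \<omega>, \<xi> k \<omega>))"
  shows "(\<integral>\<omega>. \<phi> (X \<omega>, \<xi> k \<omega>) \<partial>M) = (\<integral>\<omega>. (\<integral>s. \<phi> (X \<omega>, s) \<partial>D) \<partial>M)"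
proof -
  interpret D: prob_space D by (rule prob_space_D)
  note [measurable] = measurable_past_imp_measurable[OF X] \<phi>
  interpret X: prob_space "distr M N X" by (rule prob_space_distr) measurable
  interpret P: pair_sigma_finite "distr M N X" D ..
  have "(\<integral>\<omega>. \<phi> (X \<omega>, \<xi> k \<omega>) \<partial>M) = (\<integral>p. \<phi> p \<partial>distr M (N \<Otimes>\<^sub>M D) (\<lambda>\<omega>. (X \<omega>, \<xi> k \<omega>)))"
    by (simp add: integral_distr)
  also have "\<dots> = (\<integral>x. (\<integral>s. \<phi> (x, s) \<partial>D) \<partial>distr M N X)"
    unfolding joint_law[OF X]
  proof (rule P.integral_fst'[symmetric])
    have "integrable (distr M (N \<Otimes>\<^sub>M D) (\<lambda>\<omega>. (X \<omega>, \<xi> k \<omega>))) \<phi>"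
      using int by (subst integrable_distr_eq) auto
    then show "integrable (distr M N X \<Otimes>\<^sub>M D) \<phi>" unfolding joint_law[OF X] .
  qed
  also have "\<dots> = (\<integral>\<omega>. (\<integral>s. \<phi> (X \<omega>, s) \<partial>D) \<partial>M)"
    by (rule integral_distr) measurable
  finally show ?thesis .
qed

section \<open>Moments of the gradient error at adapted points\<close>

lemma measurable_past_error:
  assumes "Y \<in> borel_measurable (past k)"
  shows "(\<lambda>\<omega>. e (Y \<omega>) (\<xi> k \<omega>)) \<in> borel_measurable (past (Suc k))"
proof -
  have "(\<lambda>\<omega>. (Y \<omega>, \<xi> k \<omega>)) \<in> measurable (past (Suc k)) (borel \<Otimes>\<^sub>M D)"
    using measurable_past_Suc[OF assms] sample_measurable_past[of k "Suc k"] by simp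
  from measurable_compose[OF this measurable_error] show ?thesis by simp
qed

text \<open>The variance bound is uniform in the point, so it survives inserting a random point that
  is independent of the fresh sample.\<close>

lemma error_second_moment:
  assumes Y: "Y \<in> borel_measurable (past k)"
  shows "square_integrable M (\<lambda>\<omega>. e (Y \<omega>) (\<xi> k \<omega>))"
    and "(\<integral>\<omega>. (norm (e (Y \<omega>) (\<xi> k \<omega>)))\<^sup>2 \<partial>M) \<le> \<sigma>\<^sup>2"
proof -
  have [measurable]: "(\<lambda>\<omega>. e (Y \<omega>) (\<xi> k \<omega>)) \<in> borel_measurable M"
    using measurable_past_error[OF Y] by (rule measurable_past_imp_measurable)
  note [measurable] = measurable_error
  have "(\<integral>\<^sup>+\<omega>. ennreal ((norm (e (Y \<omega>) (\<xi> k \<omega>)))\<^sup>2) \<partial>M)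
      = (\<integral>\<^sup>+\<omega>. (\<integral>\<^sup>+s. ennreal ((norm (e (Y \<omega>) s))\<^sup>2) \<partial>D) \<partial>M)"
    using nn_integral_fresh_sample[OF Y, of "\<lambda>(x, s). ennreal ((norm (e x s))\<^sup>2)"]
    by (simp add: split_beta')
  also have "\<dots> \<le> (\<integral>\<^sup>+\<omega>. ennreal (\<sigma>\<^sup>2) \<partial>M)"
    using square_integrable_error variance_error
    by (intro nn_integral_mono) (simp add: nn_integral_eq_integral ennreal_leI)
  also have "\<dots> = ennreal (\<sigma>\<^sup>2)" by (simp add: emeasure_space_1)
  finally have bound: "(\<integral>\<^sup>+\<omega>. ennreal ((norm (e (Y \<omega>) (\<xi> k \<omega>)))\<^sup>2) \<partial>M) \<le> ennreal (\<sigma>\<^sup>2)" .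
  then have int: "integrable M (\<lambda>\<omega>. (norm (e (Y \<omega>) (\<xi> k \<omega>)))\<^sup>2)"
    by (intro integrableI_bounded) (auto intro: le_less_trans)
  then show "square_integrable M (\<lambda>\<omega>. e (Y \<omega>) (\<xi> k \<omega>))"
    by (simp add: square_integrable_def)
  show "(\<integral>\<omega>. (norm (e (Y \<omega>) (\<xi> k \<omega>)))\<^sup>2 \<partial>M) \<le> \<sigma>\<^sup>2"
    using bound int by (simp add: nn_integral_eq_integral)
qed

lemma error_uncorrelated:
  assumes Y: "Y \<in> borel_measurable (past k)"
    and Z: "Z \<in> borel_measurable (past k)" "square_integrable M Z"
  shows "(\<integral>\<omega>. Z \<omega> \<bullet> e (Y \<omega>) (\<xi> k \<omega>) \<partial>M) = 0"
proof -
  note [measurable] = measurable_error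
  \<comment> \<open>Freezing the pair \<open>(Y, Z)\<close> makes \<open>Z\<close> constant in the
    inner integral, where the mean of \<open>e\<close> vanishes at every point.\<close>
  let ?\<phi> = "\<lambda>p. snd (fst p) \<bullet> (\<lambda>(x, s). e x s) (fst (fst p), snd p)"
  have YZ: "(\<lambda>\<omega>. (Y \<omega>, Z \<omega>)) \<in> measurable (past k) (borel \<Otimes>\<^sub>M borel)"
    using Y Z by simp
  have \<phi>: "?\<phi> \<in> borel_measurable ((borel \<Otimes>\<^sub>M borel) \<Otimes>\<^sub>M D)" by measurable
  have "integrable M (\<lambda>\<omega>. ?\<phi> ((Y \<omega>, Z \<omega>), \<xi> k \<omega>))"
    using square_integrable_inner[OF Z(2) error_second_moment(1)[OF Y]] by simp
  from integral_fresh_sample[OF YZ \<phi> this]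
  have "(\<integral>\<omega>. Z \<omega> \<bullet> e (Y \<omega>) (\<xi> k \<omega>) \<partial>M) = (\<integral>\<omega>. (\<integral>s. Z \<omega> \<bullet> e (Y \<omega>) s \<partial>D) \<partial>M)"
    by simp
  then show ?thesis by (simp add: integrable_error mean_error)
qed

section \<open>Adaptedness and square integrability of the iterates\<close>

text \<open>Induction on \<open>x k\<close> and \<open>v k\<close> together. The Lipschitz gradient
  preserves square integrability, and the error contributes a bounded second moment.\<close>

lemma accelerated_iterates_adapted:
  assumes lipschitz: "C-lipschitz_on UNIV (gradient f)"
    and scheme: "\<And>\<omega>. \<omega> \<in> space M \<Longrightarrow>
      accelerated_scheme f \<mu> L h x0 v0 (\<lambda>k. e (y k \<omega>) (\<xi> k \<omega>)) (\<lambda>k. x k \<omega>) (\<lambda>k. y k \<omega>) (\<lambda>k. v k \<omega>)"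
  shows "(x k \<in> borel_measurable (past k) \<and> square_integrable M (x k))
    \<and> (y k \<in> borel_measurable (past k) \<and> square_integrable M (y k))
    \<and> (v k \<in> borel_measurable (past k) \<and> square_integrable M (v k))"
proof -
  define w where "w k = momentum_weight \<mu> h k" for k
  have init: "x 0 \<omega> = x0" "v 0 \<omega> = v0"
    and y: "y k \<omega> = (1 - w k) *\<^sub>R x k \<omega> + w k *\<^sub>R v k \<omega>"
    and x_Suc: "x (Suc k) \<omega> = x k \<omega> + (w k *\<^sub>R (v k \<omega> - x k \<omega>)
      - (h k / sqrt L) *\<^sub>R (gradient f (y k \<omega>) + e (y k \<omega>) (\<xi> k \<omega>)))"
    and v_Suc: "v (Suc k) \<omega> = v k \<omega> + (w k *\<^sub>R (x k \<omega> - v k \<omega>)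
      - (h k / sqrt \<mu>) *\<^sub>R (gradient f (y k \<omega>) + e (y k \<omega>) (\<xi> k \<omega>)))"
    if "\<omega> \<in> space M" for k \<omega>
    using scheme[OF that] unfolding accelerated_scheme_def Let_def w_def by (simp_all add: diff_eq_eq add.commute)
  have gradient: "gradient f \<in> borel_measurable borel"
    using lipschitz by (intro borel_measurable_continuous_onI lipschitz_on_continuous_on)
  \<comment> \<open>\<open>y k\<close> combines \<open>x k\<close> and \<open>v k\<close> without a
    new sample, hence keeps the index \<open>k\<close>; this is what makes \<open>\<xi> k\<close>
    fresh for it.\<close>
  have y_adapted: "y k \<in> borel_measurable (past k) \<and> square_integrable M (y k)"
    if "x k \<in> borel_measurable (past k)" "square_integrable M (x k)"
      "v k \<in> borel_measurable (past k)" "square_integrable M (v k)" for k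
  proof
    show "y k \<in> borel_measurable (past k)"
      using that by (subst measurable_cong[OF y]) auto
    show "square_integrable M (y k)"
      using that by (subst square_integrable_cong[OF y])
        (auto intro: square_integrable_add square_integrable_scaleR)
  qed
  have "(x k \<in> borel_measurable (past k) \<and> square_integrable M (x k))
      \<and> (v k \<in> borel_measurable (past k) \<and> square_integrable M (v k))"
  proof (induction k)
    case 0
    show ?case
      by (subst measurable_cong[OF init(1)], simp, subst square_integrable_cong[OF init(1)], simp,
          subst measurable_cong[OF init(2)], simp, subst square_integrable_cong[OF init(2)], simp)
        (simp add: square_integrable_const)
  next
    case (Suc k)
    then have x: "x k \<in> borel_measurable (past k)" "square_integrable M (x k)"
      and v: "v k \<in> borel_measurable (past k)" "square_integrable M (v k)" by auto
    then have y: "y k \<in> borel_measurable (past k)" "square_integrable M (y k)"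
      using y_adapted by auto
    define G where "G \<omega> = gradient f (y k \<omega>) + e (y k \<omega>) (\<xi> k \<omega>)" for \<omega>
    \<comment> \<open>\<open>G\<close> contains \<open>\<xi> k\<close>, so it is placed in
      \<open>past (Suc k)\<close>, the level of the next iterates.\<close>
    have "G \<in> borel_measurable (past (Suc k))"
      unfolding G_def using measurable_past_error[OF y(1)]
        measurable_compose[OF measurable_past_Suc[OF y(1)] gradient] by simp
    moreover have "square_integrable M G"
      unfolding G_def
      by (intro square_integrable_add square_integrable_lipschitz[OF y(2) lipschitz] error_second_moment y)
    moreover note measurable_past_Suc[OF x(1)] measurable_past_Suc[OF v(1)]
    \<comment> \<open>Both updates have this form, with the roles of \<open>x k\<close> and
      \<open>v k\<close> exchanged.\<close>
    ultimately have "(\<lambda>\<omega>. p \<omega> + (a *\<^sub>R (q \<omega> - p \<omega>) - b *\<^sub>R G \<omega>)) \<in> borel_measurable (past (Suc k))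
        \<and> square_integrable M (\<lambda>\<omega>. p \<omega> + (a *\<^sub>R (q \<omega> - p \<omega>) - b *\<^sub>R G \<omega>))"
      if "(p, q) \<in> {(x k, v k), (v k, x k)}" for p q a b
      using that x(2) v(2)
      by (auto intro!: square_integrable_add square_integrable_diff square_integrable_scaleR)
    then show ?case
      using measurable_cong[of "past (Suc k)" "x (Suc k)", OF x_Suc]
        measurable_cong[of "past (Suc k)" "v (Suc k)", OF v_Suc]
        square_integrable_cong[of M "x (Suc k)", OF x_Suc]
        square_integrable_cong[of M "v (Suc k)", OF v_Suc]
      by (simp add: G_def)
  qed
  then show ?thesis using y_adapted by blast
qed

end

section \<open>Integrability of the energy and its expected decrease\<close>

text \<open>The gap \<open>f (X \<omega>) - f xstar\<close> lies between 0 and the quadratic upper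
  model at \<open>xstar\<close>, which is integrable for square integrable \<open>X\<close>.\<close>

lemma (in finite_measure) integrable_L_smooth:
  fixes f :: "'b::euclidean_space \<Rightarrow> real"
  assumes smooth: "L_smooth L f" and continuous: "continuous_on UNIV f"
    and minimizer: "\<And>x. f xstar \<le> f x" and X: "square_integrable M X"
  shows "integrable M (\<lambda>\<omega>. f (X \<omega>))"
proof -
  define g where "g = gradient f xstar"
  have X': "square_integrable M (\<lambda>\<omega>. X \<omega> - xstar)"
    by (intro square_integrable_diff X square_integrable_const)
  have "integrable M (\<lambda>\<omega>. f (X \<omega>) - f xstar)"
  proof (rule Bochner_Integration.integrable_bound)
    show "integrable M (\<lambda>\<omega>. g \<bullet> (X \<omega> - xstar) + L / 2 * (norm (X \<omega> - xstar))\<^sup>2)"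
      using square_integrable_inner[OF square_integrable_const X'] X'
      by (intro Bochner_Integration.integrable_add) (auto simp: square_integrable_def)
    have "f \<in> borel_measurable borel"
      using continuous by (rule borel_measurable_continuous_onI)
    then show "(\<lambda>\<omega>. f (X \<omega>) - f xstar) \<in> borel_measurable M"
      using X by (auto simp: square_integrable_def)
    show "AE \<omega> in M. norm (f (X \<omega>) - f xstar)
        \<le> norm (g \<bullet> (X \<omega> - xstar) + L / 2 * (norm (X \<omega> - xstar))\<^sup>2)"
    proof (rule AE_I2)
      fix \<omega>
      show "norm (f (X \<omega>) - f xstar) \<le> norm (g \<bullet> (X \<omega> - xstar) + L / 2 * (norm (X \<omega> - xstar))\<^sup>2)"
        using L_smoothD[OF smooth, of "X \<omega>" xstar] minimizer[of "X \<omega>"]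
        by (simp add: g_def norm_minus_commute)
    qed
  qed
  from Bochner_Integration.integrable_add[OF this integrable_const[of "f xstar"]] show ?thesis by simp
qed

lemma (in stochastic_gradient_error) expected_energy_decrease:
  fixes f :: "'a \<Rightarrow> real"
  assumes differentiable: "\<And>x. f differentiable (at x)"
    and convex: "strongly_convex \<mu> f" and smooth: "L_smooth L f" and "0 < L"
    and minimizer: "\<And>x. f xstar \<le> f x"
    and h: "0 < h k" "h k \<le> 1 / sqrt L"
    and scheme: "\<And>\<omega>. \<omega> \<in> space M \<Longrightarrow>
      accelerated_scheme f \<mu> L h x0 v0 (\<lambda>k. e (y k \<omega>) (\<xi> k \<omega>)) (\<lambda>k. x k \<omega>) (\<lambda>k. y k \<omega>) (\<lambda>k. v k \<omega>)"
  shows "integrable M (\<lambda>\<omega>. energy_SC f \<mu> xstar (x k \<omega>) (v k \<omega>))"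
    and "(\<integral>\<omega>. energy_SC f \<mu> xstar (x (Suc k) \<omega>) (v (Suc k) \<omega>) \<partial>M)
      \<le> (1 - h k * sqrt \<mu>) * (\<integral>\<omega>. energy_SC f \<mu> xstar (x k \<omega>) (v k \<omega>) \<partial>M) + (h k)\<^sup>2 * \<sigma>\<^sup>2"
proof -
  note lipschitz = lipschitz_on_gradient[OF convex smooth \<open>0 < L\<close>]
  note adapted = accelerated_iterates_adapted[OF lipschitz scheme]
  have continuous: "continuous_on UNIV f"
    using differentiable differentiable_imp_continuous_within
    by (auto simp: continuous_on_eq_continuous_within)
  have energy: "integrable M (\<lambda>\<omega>. energy_SC f \<mu> xstar (x n \<omega>) (v n \<omega>))" for n
  proof -
    have "square_integrable M (\<lambda>\<omega>. v n \<omega> - xstar)"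
      using adapted by (intro square_integrable_diff square_integrable_const) auto
    moreover have "integrable M (\<lambda>\<omega>. f (x n \<omega>))"
      using adapted by (intro integrable_L_smooth[OF smooth continuous minimizer]) auto
    ultimately show ?thesis
      unfolding energy_SC_def square_integrable_def by auto
  qed
  then show "integrable M (\<lambda>\<omega>. energy_SC f \<mu> xstar (x k \<omega>) (v k \<omega>))" .
  have x: "x k \<in> borel_measurable (past k)" "square_integrable M (x k)"
    and y: "y k \<in> borel_measurable (past k)" "square_integrable M (y k)"
    and v: "v k \<in> borel_measurable (past k)" "square_integrable M (v k)"
    using adapted by auto
  define g where "g \<omega> = gradient f (y k \<omega>)" for \<omega>
  define \<epsilon> where "\<epsilon> \<omega> = e (y k \<omega>) (\<xi> k \<omega>)" for \<omega>
  \<comment> \<open>\<open>Z\<close> collects everything paired linearly with the error in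
    \<open>error_term\<close>. It is measurable in \<open>past k\<close>, so its product with
    \<open>\<epsilon>\<close> has mean zero, and
    \<open>h k * (norm (\<epsilon> \<omega>))\<^sup>2\<close> is what remains.\<close>
  define Z where "Z \<omega> = (2 * h k) *\<^sub>R g \<omega>
    - (sqrt \<mu> *\<^sub>R (x k \<omega> - y k \<omega> + v k \<omega> - xstar) + (1 / sqrt L) *\<^sub>R g \<omega>)" for \<omega>
  have g: "g \<in> borel_measurable (past k)" "square_integrable M g"
    unfolding g_def
    using lipschitz_on_continuous_on[OF lipschitz, THEN borel_measurable_continuous_onI]
      square_integrable_lipschitz[OF y(2) lipschitz] y(1) by simp_all
  have Z: "Z \<in> borel_measurable (past k)" "square_integrable M Z"
    unfolding Z_def using x y v g
    by (auto intro!: square_integrable_add square_integrable_diff square_integrable_scaleR square_integrable_const)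
  have \<epsilon>: "square_integrable M \<epsilon>" "(\<integral>\<omega>. (norm (\<epsilon> \<omega>))\<^sup>2 \<partial>M) \<le> \<sigma>\<^sup>2"
    unfolding \<epsilon>_def by (rule error_second_moment[OF y(1)])+
  have Z\<epsilon>: "integrable M (\<lambda>\<omega>. Z \<omega> \<bullet> \<epsilon> \<omega>)" "(\<integral>\<omega>. Z \<omega> \<bullet> \<epsilon> \<omega> \<partial>M) = 0"
    using square_integrable_inner[OF Z(2) \<epsilon>(1)] error_uncorrelated[OF y(1) Z] by (simp_all add: \<epsilon>_def)
  have \<beta>: "error_term f \<mu> L (h k) xstar (x k \<omega>) (y k \<omega>) (v k \<omega>) (\<epsilon> \<omega>)
      = Z \<omega> \<bullet> \<epsilon> \<omega> + h k * (norm (\<epsilon> \<omega>))\<^sup>2" for \<omega>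
    unfolding error_term_def Z_def g_def[symmetric] power2_norm_eq_inner
    by (simp add: inner_add_left inner_diff_left algebra_simps)
  let ?E = "\<lambda>n \<omega>. energy_SC f \<mu> xstar (x n \<omega>) (v n \<omega>)"
  have "(\<integral>\<omega>. ?E (Suc k) \<omega> \<partial>M)
      \<le> (\<integral>\<omega>. (1 - h k * sqrt \<mu>) * ?E k \<omega> + h k * (Z \<omega> \<bullet> \<epsilon> \<omega> + h k * (norm (\<epsilon> \<omega>))\<^sup>2) \<partial>M)"
  proof (rule integral_mono)
    show "integrable M (\<lambda>\<omega>. (1 - h k * sqrt \<mu>) * ?E k \<omega> + h k * (Z \<omega> \<bullet> \<epsilon> \<omega> + h k * (norm (\<epsilon> \<omega>))\<^sup>2))"
      using energy Z\<epsilon> \<epsilon> by (auto simp: square_integrable_def)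
    show "?E (Suc k) \<omega> \<le> (1 - h k * sqrt \<mu>) * ?E k \<omega> + h k * (Z \<omega> \<bullet> \<epsilon> \<omega> + h k * (norm (\<epsilon> \<omega>))\<^sup>2)"
      if "\<omega> \<in> space M" for \<omega>
      using energy_decrease[OF convex smooth h scheme[OF that], of xstar] by (simp add: \<beta> \<epsilon>_def[symmetric])
  qed (rule energy)
  \<comment> \<open>The outer factor \<open>h k\<close> meets the one inside the remaining error
    term, which gives \<open>(h k)\<^sup>2\<close>.\<close>
  also have "\<dots> = (1 - h k * sqrt \<mu>) * (\<integral>\<omega>. ?E k \<omega> \<partial>M) + (h k)\<^sup>2 * (\<integral>\<omega>. (norm (\<epsilon> \<omega>))\<^sup>2 \<partial>M)"
    using energy Z\<epsilon> \<epsilon> by (simp add: square_integrable_def power2_eq_square)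
  also have "\<dots> \<le> (1 - h k * sqrt \<mu>) * (\<integral>\<omega>. ?E k \<omega> \<partial>M) + (h k)\<^sup>2 * \<sigma>\<^sup>2"
    using \<epsilon>(2) by (intro add_left_mono mult_left_mono) auto
  finally show "(\<integral>\<omega>. ?E (Suc k) \<omega> \<partial>M) \<le> (1 - h k * sqrt \<mu>) * (\<integral>\<omega>. ?E k \<omega> \<partial>M) + (h k)\<^sup>2 * \<sigma>\<^sup>2" .
qed

theorem proposition3p2:
  fixes f :: "real ^ 'n \<Rightarrow> real"
    and \<mu> L :: real
    and h :: "nat \<Rightarrow> real"
    and xstar x0 v0 :: "real ^ 'n"
  assumes "\<forall>x. f differentiable (at x)"
    and "strongly_convex \<mu> f"
    and "L_smooth L f"
    and "\<forall>x. f xstar \<le> f x"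
    and "\<forall>k. 0 < h k \<and> h k \<le> 1 / sqrt L"
  shows "(\<forall>err x y v. accelerated_scheme f \<mu> L h x0 v0 err x y v \<longrightarrow>
           (\<forall>k. energy_SC f \<mu> xstar (x (Suc k)) (v (Suc k))
                \<le> (1 - h k * sqrt \<mu>) * energy_SC f \<mu> xstar (x k) (v k)
                  + h k * error_term f \<mu> L (h k) xstar (x k) (y k) (v k) (err k)))
       \<and> (\<forall>(M :: 'w measure) (D :: 's measure) \<xi> e \<sigma> x y v.
           stochastic_gradient_error M D \<xi> e \<sigma> \<longrightarrow>
           (\<forall>\<omega>\<in>space M. accelerated_scheme f \<mu> L h x0 v0 (\<lambda>k. e (y k \<omega>) (\<xi> k \<omega>))
                           (\<lambda>k. x k \<omega>) (\<lambda>k. y k \<omega>) (\<lambda>k. v k \<omega>)) \<longrightarrow>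
           (\<forall>k. integrable M (\<lambda>\<omega>. energy_SC f \<mu> xstar (x k \<omega>) (v k \<omega>))
              \<and> (\<integral>\<omega>. energy_SC f \<mu> xstar (x (Suc k) \<omega>) (v (Suc k) \<omega>) \<partial>M)
                \<le> (1 - h k * sqrt \<mu>) * (\<integral>\<omega>. energy_SC f \<mu> xstar (x k \<omega>) (v k \<omega>) \<partial>M)
                  + (h k)\<^sup>2 * \<sigma>\<^sup>2))"
proof (intro conjI allI impI)
  fix err x y v k
  assume "accelerated_scheme f \<mu> L h x0 v0 err x y v"
  then show "energy_SC f \<mu> xstar (x (Suc k)) (v (Suc k))
      \<le> (1 - h k * sqrt \<mu>) * energy_SC f \<mu> xstar (x k) (v k)
        + h k * error_term f \<mu> L (h k) xstar (x k) (y k) (v k) (err k)"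
    using assms by (intro energy_decrease) auto
next
  fix M :: "'w measure" and D :: "'s measure" and \<xi> e \<sigma> x y v k
  assume "stochastic_gradient_error M D \<xi> e \<sigma>"
    and scheme: "\<forall>\<omega>\<in>space M. accelerated_scheme f \<mu> L h x0 v0 (\<lambda>k. e (y k \<omega>) (\<xi> k \<omega>))
      (\<lambda>k. x k \<omega>) (\<lambda>k. y k \<omega>) (\<lambda>k. v k \<omega>)"
  then interpret stochastic_gradient_error M D \<xi> e \<sigma> by simp
  have "0 < h k" "h k \<le> 1 / sqrt L" using assms(5) by auto
  then have "0 < 1 / sqrt L" by linarith
  then have "0 < L" by simp
  note step = expected_energy_decrease[where f = f and \<mu> = \<mu> and L = L and h = h and k = k
      and xstar = xstar and ?x0.0 = x0 and ?v0.0 = v0 and x = x and y = y and v = v]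
  show "integrable M (\<lambda>\<omega>. energy_SC f \<mu> xstar (x k \<omega>) (v k \<omega>))"
    using assms \<open>0 < L\<close> scheme by (intro step(1)) auto
  show "(\<integral>\<omega>. energy_SC f \<mu> xstar (x (Suc k) \<omega>) (v (Suc k) \<omega>) \<partial>M)
      \<le> (1 - h k * sqrt \<mu>) * (\<integral>\<omega>. energy_SC f \<mu> xstar (x k \<omega>) (v k \<omega>) \<partial>M) + (h k)\<^sup>2 * \<sigma>\<^sup>2"
    using assms \<open>0 < L\<close> scheme by (intro step(2)) auto
qed

end
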